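(* For every dimension $d$ and every real number $\alpha>0$ there exists $\beta>0$ such that the following holds. Let $P$ be a monotone property of boxes, and let $\mathcal{B}$ be a finite family of boxes in $\mathbb{R}^d$ such that at least $\alpha\binom{|\mathcal{B}|}{2d}$ of the $2d$-tuples (subfamilies of size $2d$) of $\mathcal{B}$ are $P$-intersecting. Then there is a $P$-intersecting subfamily $\mathcal{B}'\subseteq\mathcal{B}$ of cardinality at least $\beta|\mathcal{B}|$. For large enough $|\mathcal{B}|$, we can choose $\beta=1-2d(1-\alpha)^{1/(2d+1)}$.
   Context: A box in $\mathbb{R}^d$ is an axis-parallel box, i.e. a set of the form $[a_1,b_1]\times\cdots\times[a_d,b_d]$ (an intersection of $2d$ closed coordinate halfspaces, one for each direction $\pm e_i$); degenerate boxes and the empty set are allowed, so that an intersection of boxes is a box. A property $P$ of boxes (a class of boxes) is monotone if $B\in P$ and $B\subseteq C$ imply $C\in P$ for all boxes $B,C$. A family of boxes is $P$-intersecting if the intersection of its members has property $P$.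
   Formalization: The first part assumes |B| ≥ 2d and the dimension is d ≥ 1; for |B| < 2d the 2d-tuple condition is vacuous and the claim fails (P empty, one box), and for d = 0 it fails with P = {point} and the family consisting of the empty box. *)

theory Defs
  imports "HOL-Analysis.Analysis"
begin

(* cbox a b is empty as soon as a $ i > b $ i for some i, so the empty box is included. *)
definition boxes :: "(real ^ 'n) set set" where
  "boxes = {cbox a b | a b. True}"

definition monotone_property :: "(real ^ 'n) set set \<Rightarrow> bool" where
  "monotone_property P \<longleftrightarrow>
     P \<subseteq> boxes \<and> (\<forall>B\<in>boxes. \<forall>C\<in>boxes. B \<in> P \<longrightarrow> B \<subseteq> C \<longrightarrow> C \<in> P)"

(* Families of boxes are indexed, so that a box may occur repeatedly; a subfamily is a set J of
   indices. For J = {} the intersection is the whole space, which is not a box; so the empty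
   family is not P-intersecting for any class P of boxes. *)
definition P_intersecting ::
    "(real ^ 'n) set set \<Rightarrow> ('i \<Rightarrow> (real ^ 'n) set) \<Rightarrow> 'i set \<Rightarrow> bool" where
  "P_intersecting P B J \<longleftrightarrow> (\<Inter>j\<in>J. B j) \<in> P"

end

theory Submission
  imports Defs
begin

text \<open>
  A box is an intersection of \<^term>\<open>k = 2 * d\<close> halfspaces, one for each outer normal
  \<open>\<plusminus>e\<^sub>i\<close>, and the halfspaces with a given normal are linearly ordered by inclusion. Hence the
  members of a family that are tightest in the \<open>k\<close> directions alone determine its
  intersection, and for a monotone property nothing but the following matters: if a
  \<open>P\<close>-intersecting family \<open>T\<close> dominates a nonempty family \<open>J\<close>, meaning that in every direction
  each member of \<open>J\<close> is at least as loose as some member of \<open>T\<close>, then \<open>J\<close> is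
  \<open>P\<close>-intersecting. The combinatorial part of the argument takes place in the locale
  \<open>domination\<close>, which keeps only this rule.

  A positive \<open>\<beta>\<close> for every \<open>\<alpha>\<close> comes from double counting. Set one direction aside. In a good
  \<open>k\<close>-set \<open>T\<close>, some \<open>k - 1\<close> members \<open>S\<close> dominate \<open>T\<close> in the other directions. There are only
  \<open>n choose (k - 1)\<close> choices for \<open>S\<close>, so a single \<open>S\<close> serves for at least
  \<open>\<alpha> (n - k + 1) / k\<close> good sets. The one among them that is tightest in the direction set
  aside dominates their union, which is therefore good; this gives \<open>\<beta> = \<alpha> / k\<close>
  (\<open>linear_size_good_subfamily\<close>).

  The explicit \<open>\<beta>\<close> comes from deleting tight boxes. Going through the directions one after
  another, delete the \<open>m\<close> tightest remaining boxes. A transversal of the \<open>k\<close> deleted blocks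
  dominates everything that remains, so either the \<open>n - k m\<close> remaining boxes form a good
  family, or all \<open>m ^ k\<close> transversals are bad (\<open>good_remainder_if_few_bad\<close>). With
  \<open>m = \<lfloor>\<epsilon> n\<rfloor>\<close> and \<open>\<epsilon> ^ (k + 1) = 1 - \<alpha>\<close> the second case is impossible for large \<open>n\<close>,
  since \<open>m ^ k\<close> is about \<open>\<epsilon> ^ k n ^ k\<close> while at most \<open>\<epsilon> ^ (k + 1) n ^ k\<close> sets are bad. For
  \<open>\<alpha> = 1\<close> one has \<open>\<epsilon> = 0\<close>, and the claim is the Helly property \<open>good_if_all_good\<close>.
\<close>

section \<open>Extremal elements for several linear orders\<close>

lemma ex_minimiser:
  fixes key :: "'i \<Rightarrow> real"
  assumes "finite A" "A \<noteq> {}"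
  shows "\<exists>x\<in>A. \<forall>y\<in>A. key x \<le> key y"
  using arg_min_if_finite(1)[OF assms, of key] arg_min_least[OF assms, of _ key] by blast

text \<open>Collecting a minimiser for each direction yields at most \<open>card D\<close> elements; the set is then
  padded to the prescribed size \<open>c\<close>.\<close>

lemma ex_dominating_subset:
  fixes key :: "'e \<Rightarrow> 'i \<Rightarrow> real"
  assumes "finite T" "finite D" "card D \<le> c" "c \<le> card T"
  shows "\<exists>S\<subseteq>T. card S = c \<and> (\<forall>e\<in>D. \<forall>t\<in>T. \<exists>s\<in>S. key e s \<le> key e t)"
proof (cases "T = {}")
  case True
  then show ?thesis using assms by auto
next
  case False
  have "\<forall>e. \<exists>x. x \<in> T \<and> (\<forall>t\<in>T. key e x \<le> key e t)"
    using ex_minimiser[OF assms(1) False] by metis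
  then obtain x where x: "\<And>e. x e \<in> T" "\<And>e t. t \<in> T \<Longrightarrow> key e (x e) \<le> key e t"
    by metis
  have "card (x ` D) \<le> c"
    using card_image_le[OF assms(2), of x] assms(3) by linarith
  moreover have "x ` D \<subseteq> T" using x(1) by auto
  ultimately obtain S where "x ` D \<subseteq> S" "S \<subseteq> T" "card S = c"
    using exists_subset_between[of "x ` D" c T] assms by blast
  then show ?thesis using x(2) by blast
qed

lemma ex_initial_segment:
  fixes key :: "'i \<Rightarrow> real"
  assumes "finite R" "m \<le> card R"
  shows "\<exists>X\<subseteq>R. card X = m \<and> (\<forall>x\<in>X. \<forall>y\<in>R - X. key x \<le> key y)"
  using assms(2)
proof (induction m)
  case 0
  then show ?case by (intro exI[of _ "{}"]) auto
next
  case (Suc m)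
  then obtain X where X: "X \<subseteq> R" "card X = m" "\<forall>x\<in>X. \<forall>y\<in>R - X. key x \<le> key y"
    by auto
  have fin: "finite X" using X(1) assms(1) finite_subset by blast
  have ne: "R - X \<noteq> {}" using X Suc.prems by auto
  obtain z where z: "z \<in> R - X" "\<forall>y\<in>R - X. key z \<le> key y"
    using ex_minimiser[OF finite_Diff[OF assms(1)] ne] by metis
  show ?case
    using X z fin by (intro exI[of _ "insert z X"]) auto
qed

text \<open>The blocks are cut off one direction at a time, each from what the previous ones left over.
  This keeps them disjoint, so that different transversals have different ranges.\<close>

lemma ex_disjoint_initial_segments:
  fixes key :: "'e \<Rightarrow> 'i \<Rightarrow> real"
  assumes "finite E" "finite I" "card E * m \<le> card I"
  shows "\<exists>H. (\<forall>e\<in>E. H e \<subseteq> I \<and> card (H e) = m) \<and> disjoint_family_on H E \<and>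
             (\<forall>e\<in>E. \<forall>h\<in>H e. \<forall>j\<in>I - \<Union>(H ` E). key e h \<le> key e j)"
  using assms(1,3)
proof (induction E rule: finite_induct)
  case empty
  then show ?case by (auto simp: disjoint_family_on_def)
next
  case (insert a E)
  then obtain H where H: "\<forall>e\<in>E. H e \<subseteq> I \<and> card (H e) = m" "disjoint_family_on H E"
    "\<forall>e\<in>E. \<forall>h\<in>H e. \<forall>j\<in>I - \<Union>(H ` E). key e h \<le> key e j"
    by (auto simp: algebra_simps)
  let ?R = "I - \<Union>(H ` E)"
  have "card (\<Union>(H ` E)) \<le> (\<Sum>e\<in>E. card (H e))"
    using insert.hyps(1) by (rule card_UN_le)
  also have "\<dots> = card E * m" using H(1) by simp
  finally have "card (\<Union>(H ` E)) \<le> card E * m" .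
  moreover have "card ?R = card I - card (\<Union>(H ` E))"
  proof (rule card_Diff_subset)
    show "\<Union>(H ` E) \<subseteq> I" using H(1) by auto
    then show "finite (\<Union>(H ` E))" using assms(2) finite_subset by blast
  qed
  ultimately have "m \<le> card ?R" using insert.prems insert.hyps by (simp add: algebra_simps)
  then obtain X where X: "X \<subseteq> ?R" "card X = m" "\<forall>x\<in>X. \<forall>y\<in>?R - X. key a x \<le> key a y"
    using ex_initial_segment[of ?R m "key a"] assms(2) by auto
  let ?H = "H(a := X)"
  have "?H ` E = H ` E" using insert.hyps by (intro image_cong) auto
  then have UN: "\<Union>(?H ` insert a E) = X \<union> \<Union>(H ` E)"
    by (simp only: image_insert fun_upd_same Union_insert)
  have "\<forall>e\<in>insert a E. ?H e \<subseteq> I \<and> card (?H e) = m" using H(1) X by auto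
  moreover have "disjoint_family_on ?H (insert a E)"
    using H(2) X(1) insert.hyps(2) unfolding disjoint_family_on_def by (auto; blast)
  moreover have "\<forall>e\<in>insert a E. \<forall>h\<in>?H e. \<forall>j\<in>I - \<Union>(?H ` insert a E). key e h \<le> key e j"
    unfolding UN using H(3) X(3) by auto
  ultimately show ?case by blast
qed

lemma card_transversals:
  assumes "finite E" "disjoint_family_on H E" "\<And>e. e \<in> E \<Longrightarrow> card (H e) = m"
  shows "card ((\<lambda>f. f ` E) ` PiE E H) = m ^ card E"
    and "\<And>f. f \<in> PiE E H \<Longrightarrow> card (f ` E) = card E"
proof -
  have same: "e = e'" if "e \<in> E" "e' \<in> E" "v \<in> H e" "v \<in> H e'" for e e' v
    using assms(2) that unfolding disjoint_family_on_def by blast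
  have "inj_on (\<lambda>f. f ` E) (PiE E H)"
  proof (rule inj_onI)
    fix f g assume f: "f \<in> PiE E H" and g: "g \<in> PiE E H" and eq: "f ` E = g ` E"
    show "f = g"
    proof (rule PiE_ext[OF f g])
      fix e assume e: "e \<in> E"
      then obtain e' where e': "e' \<in> E" "f e = g e'" using eq by blast
      have "f e \<in> H e" "g e' \<in> H e'" using PiE_mem[OF f e] PiE_mem[OF g e'(1)] by simp_all
      then have "e = e'" using same e e' by metis
      then show "f e = g e" using e' by simp
    qed
  qed
  then show "card ((\<lambda>f. f ` E) ` PiE E H) = m ^ card E"
    using assms by (simp add: card_image card_PiE)
  show "card (f ` E) = card E" if f: "f \<in> PiE E H" for f
  proof (rule card_image, rule inj_onI)
    fix e e' assume e: "e \<in> E" "e' \<in> E" and eq: "f e = f e'"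
    have "f e \<in> H e" "f e' \<in> H e'" using PiE_mem[OF f e(1)] PiE_mem[OF f e(2)] by simp_all
    then show "e = e'" using same e eq by metis
  qed
qed

section \<open>Counting\<close>

lemma ex_large_fibre:
  assumes "finite A" "finite C" "f ` A \<subseteq> C" "A \<noteq> {}"
  shows "\<exists>c\<in>C. card A \<le> card {a \<in> A. f a = c} * card C"
proof (rule ccontr)
  assume "\<not> ?thesis"
  then have small: "card {a \<in> A. f a = c} * card C < card A" if "c \<in> C" for c
    using that by (auto simp: not_le)
  have ne: "C \<noteq> {}" using assms by auto
  have "card A * card C = (\<Sum>c\<in>C. card {a \<in> A. f a = c} * card C)"
    using sum.group[OF assms(1-3), of "\<lambda>_. 1::nat"] by (simp flip: sum_distrib_right)
  also have "\<dots> < (\<Sum>c\<in>C. card A)"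
    using small assms(2) ne by (intro sum_strict_mono) auto
  finally show False by (simp add: mult.commute)
qed

lemma choose_mult_eq_choose_pred_mult:
  assumes "1 \<le> k" "k \<le> n"
  shows "(n choose k) * k = (n choose (k - 1)) * (n - k + 1)"
proof -
  obtain j where k: "k = Suc j" using assms by (cases k) auto
  obtain l where n: "n = Suc l" using assms by (cases n) auto
  have "j \<le> l" using assms k n by simp
  have "(Suc l - j) * (Suc l choose j) = Suc l * (l choose j)"
    using binomial_absorb_comp[of "Suc l" j] by simp
  moreover have "Suc j * (Suc l choose Suc j) = Suc l * (l choose j)"
    by (rule Suc_times_binomial)
  ultimately show ?thesis
    using k n \<open>j \<le> l\<close> by (simp add: mult.commute Suc_diff_le)
qed

text \<open>By Bernoulli's inequality, rounding \<open>\<epsilon> n\<close> down retains a factor of at least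
  \<open>1 - k / (\<epsilon> n)\<close> in the \<open>k\<close>-th power, and this exceeds \<open>\<epsilon>\<close> for large \<open>n\<close>.\<close>

lemma power_floor_gt:
  fixes \<epsilon> :: real
  assumes "0 < \<epsilon>" "\<epsilon> < 1" "1 \<le> k" "real n > real k / (\<epsilon> * (1 - \<epsilon>))"
  shows "\<epsilon> ^ Suc k * real n ^ k < real (nat \<lfloor>\<epsilon> * real n\<rfloor>) ^ k"
proof -
  have "0 \<le> real k / (\<epsilon> * (1 - \<epsilon>))" using assms by simp
  then have n: "0 < real n" using assms(4) by linarith
  have key: "real k < \<epsilon> * real n * (1 - \<epsilon>)"
    using assms by (simp add: divide_less_eq algebra_simps)
  let ?y = "\<epsilon> * real n"
  have y: "0 < ?y" using assms n by simp
  have "?y * (1 - \<epsilon>) \<le> ?y * 1" using y assms by (intro mult_left_mono) auto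
  then have y1: "1 < ?y" using key assms(3) by linarith
  have base: "(1 + (- 1 / ?y)) * ?y = ?y - 1"
    using assms(1) n by (simp add: field_simps)
  have "real k / ?y < 1 - \<epsilon>" using key y by (simp only: pos_divide_less_eq mult.commute)
  then have "\<epsilon> < 1 - real k / ?y" by linarith
  also have "\<dots> = 1 + real k * (- 1 / ?y)" by simp
  also have "\<dots> \<le> (1 + (- 1 / ?y)) ^ k"
    using y1 by (intro Bernoulli_inequality) (simp add: field_simps)
  finally have "\<epsilon> * ?y ^ k < (1 + (- 1 / ?y)) ^ k * ?y ^ k" using y by simp
  also have "\<dots> = (?y - 1) ^ k" by (simp only: base flip: power_mult_distrib)
  also have "\<dots> \<le> real (nat \<lfloor>?y\<rfloor>) ^ k"
    using y1 by (intro power_mono) linarith+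
  finally show ?thesis by (simp add: power_mult_distrib)
qed

section \<open>Families closed under domination\<close>

text \<open>\<open>E\<close> is the set of directions, and a small value of \<open>key e i\<close> means that the member \<open>i\<close> is
  tight in direction \<open>e\<close>. The rule has to exclude \<open>J = {}\<close>: every family dominates the empty
  one, whose intersection is the whole space and hence not a box.\<close>

locale domination =
  fixes I :: "'i set" and E :: "'e set" and key :: "'e \<Rightarrow> 'i \<Rightarrow> real"
    and good :: "'i set \<Rightarrow> bool"
  assumes finite_I: "finite I"
    and finite_E: "finite E" and E_ne: "E \<noteq> {}"
    and good_if_dominated:
      "\<lbrakk>T \<subseteq> I; good T; J \<subseteq> I; J \<noteq> {}; \<forall>e\<in>E. \<forall>j\<in>J. \<exists>t\<in>T. key e t \<le> key e j\<rbrakk> \<Longrightarrow> good J"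
begin

lemma card_E_pos: "1 \<le> card E"
  using finite_E E_ne by (simp add: Suc_le_eq card_gt_0_iff)

text \<open>Some \<open>card E\<close> members dominate the whole family.\<close>

lemma good_if_all_good:
  assumes "card E \<le> card I" "\<And>T. T \<subseteq> I \<Longrightarrow> card T = card E \<Longrightarrow> good T"
  shows "good I"
proof -
  obtain S where S: "S \<subseteq> I" "card S = card E" "\<forall>e\<in>E. \<forall>t\<in>I. \<exists>s\<in>S. key e s \<le> key e t"
    using ex_dominating_subset[OF finite_I finite_E order_refl assms(1), of key] by blast
  have "I \<noteq> {}" using assms(1) card_E_pos by auto
  then show ?thesis using good_if_dominated[of S I] S assms(2) by auto
qed

text \<open>If \<open>S\<close> dominates each \<open>T\<close> in a family \<open>F\<close> of good sets in all directions but \<open>a\<close>, then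
  the member of \<open>F\<close> that contains a tightest element for \<open>a\<close> dominates the union of \<open>F\<close>. As
  each \<open>T\<close> has only one element outside \<open>S\<close>, this union has about as many elements as \<open>F\<close>
  has members.\<close>

lemma good_Union_of_fibre:
  assumes F: "F \<noteq> {}" "\<And>T. T \<in> F \<Longrightarrow> T \<subseteq> I \<and> good T \<and> card T = Suc (card S) \<and> S \<subseteq> T"
    and dom: "\<And>T e t. T \<in> F \<Longrightarrow> e \<in> E - {a} \<Longrightarrow> t \<in> T \<Longrightarrow> \<exists>s\<in>S. key e s \<le> key e t"
  shows "good (\<Union>F)" "\<Union>F \<subseteq> I" "card F + card S \<le> card (\<Union>F)"
proof -
  let ?J = "\<Union>F"
  show J: "?J \<subseteq> I" using F(2) by auto
  have finJ: "finite ?J" using J finite_I by (rule finite_subset)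
  obtain T0 where T0: "T0 \<in> F" using F(1) by blast
  have "T0 \<noteq> {}" using F(2)[OF T0] by auto
  then have J_ne: "?J \<noteq> {}" using T0 by auto
  have SJ: "S \<subseteq> ?J" using F(2)[OF T0] T0 by auto
  then have finS: "finite S" using finJ finite_subset by blast
  obtain u where u: "u \<in> ?J" "\<forall>j\<in>?J. key a u \<le> key a j"
    using ex_minimiser[OF finJ J_ne] by metis
  then obtain U where U: "U \<in> F" "u \<in> U" by auto
  have "\<exists>t\<in>U. key e t \<le> key e j" if "e \<in> E" "j \<in> ?J" for e j
  proof (cases "e = a")
    case True
    then show ?thesis using u U that by auto
  next
    case False
    then show ?thesis using dom that F(2)[OF U(1)] by blast
  qed
  then show "good ?J" using good_if_dominated[of U ?J] F(2)[OF U(1)] J J_ne by blast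
  have "F \<subseteq> (\<lambda>z. insert z S) ` (?J - S)"
  proof
    fix T assume T: "T \<in> F"
    have "card (T - S) = 1" using F(2)[OF T] finS by (simp add: card_Diff_subset)
    then obtain z where z: "T - S = {z}" by (auto simp: card_1_singleton_iff)
    then have "T = insert z S" "z \<in> ?J - S" using F(2)[OF T] T by auto
    then show "T \<in> (\<lambda>z. insert z S) ` (?J - S)" by blast
  qed
  then have "card F \<le> card (?J - S)" using finJ by (meson finite_Diff surj_card_le)
  then show "card F + card S \<le> card ?J"
    using finS SJ finJ card_mono[OF finJ SJ] by (simp add: card_Diff_subset)
qed

lemma linear_size_good_subfamily:
  fixes \<alpha> :: real
  assumes pos: "0 < \<alpha>" and size: "card E \<le> card I"
    and dense: "\<alpha> * real (card I choose card E)
                  \<le> real (card {T. T \<subseteq> I \<and> card T = card E \<and> good T})"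
  shows "\<exists>J\<subseteq>I. good J \<and> \<alpha> / real (card E) * real (card I) \<le> real (card J)"
proof -
  let ?k = "card E" and ?n = "card I"
  let ?G = "{T. T \<subseteq> I \<and> card T = ?k \<and> good T}"
  let ?C = "{S. S \<subseteq> I \<and> card S = ?k - 1}"
  obtain a where a: "a \<in> E" using E_ne by blast
  have k: "1 \<le> ?k" by (rule card_E_pos)
  have finG: "finite ?G" using finite_I by simp
  have finC: "finite ?C" using finite_I by simp
  have choose_pos: "0 < ?n choose ?k" using size by simp
  have "card ?G \<le> card {T. T \<subseteq> I \<and> card T = ?k}"
    using finite_I by (intro card_mono) auto
  also have "\<dots> = ?n choose ?k" using finite_I by (simp add: n_subsets)
  finally have "\<alpha> * real (?n choose ?k) \<le> 1 * real (?n choose ?k)" using dense by simp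
  then have \<alpha>1: "\<alpha> \<le> 1" using choose_pos by (simp add: mult_le_cancel_right)
  have "0 < \<alpha> * real (?n choose ?k)" using pos choose_pos by simp
  then have G_ne: "?G \<noteq> {}" using dense by (metis card.empty not_less of_nat_0)
  have "\<forall>T\<in>?G. \<exists>S\<subseteq>T. card S = ?k - 1 \<and>
          (\<forall>e\<in>E - {a}. \<forall>t\<in>T. \<exists>s\<in>S. key e s \<le> key e t)"
  proof
    fix T assume T: "T \<in> ?G"
    then have "finite T" using finite_I finite_subset by blast
    then show "\<exists>S\<subseteq>T. card S = ?k - 1 \<and> (\<forall>e\<in>E - {a}. \<forall>t\<in>T. \<exists>s\<in>S. key e s \<le> key e t)"
      using T a finite_E by (intro ex_dominating_subset) auto
  qed
  from bchoice[OF this] obtain \<sigma> where "\<forall>T\<in>?G. \<sigma> T \<subseteq> T \<and> card (\<sigma> T) = ?k - 1 \<and>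
          (\<forall>e\<in>E - {a}. \<forall>t\<in>T. \<exists>s\<in>\<sigma> T. key e s \<le> key e t)" ..
  then have \<sigma>: "\<sigma> T \<subseteq> T \<and> card (\<sigma> T) = ?k - 1 \<and>
          (\<forall>e\<in>E - {a}. \<forall>t\<in>T. \<exists>s\<in>\<sigma> T. key e s \<le> key e t)" if "T \<in> ?G" for T
    using that by (rule bspec)
  have "\<sigma> ` ?G \<subseteq> ?C" using \<sigma> by blast
  then obtain S where S: "S \<in> ?C" "card ?G \<le> card {T \<in> ?G. \<sigma> T = S} * card ?C"
    using ex_large_fibre[OF finG finC _ G_ne] by blast
  let ?F = "{T \<in> ?G. \<sigma> T = S}"
  have card_C: "card ?C = ?n choose (?k - 1)" using finite_I by (simp add: n_subsets)
  have "0 < card ?G" using G_ne finG by (simp add: card_gt_0_iff)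
  then have "0 < card ?F * card ?C" using S(2) by linarith
  then have F_ne: "?F \<noteq> {}" by (metis card.empty less_irrefl mult_0)
  have F_sub: "T \<subseteq> I \<and> good T \<and> card T = Suc (card S) \<and> S \<subseteq> T" if "T \<in> ?F" for T
    using that \<sigma>[of T] S(1) k by auto
  have F_dom: "\<exists>s\<in>S. key e s \<le> key e t" if "T \<in> ?F" "e \<in> E - {a}" "t \<in> T" for T e t
    using that \<sigma>[of T] by blast
  note union = good_Union_of_fibre[OF F_ne F_sub F_dom]
  have large: "card ?F + card S \<le> card (\<Union>?F)" by (rule union(3))
  have "\<alpha> * real (?n - ?k + 1) * real (?n choose (?k - 1)) =
        \<alpha> * real (?n choose ?k) * real ?k"
    using choose_mult_eq_choose_pred_mult[OF k size]
    by (metis mult.assoc mult.commute of_nat_mult)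
  also have "\<dots> \<le> real (card ?G) * real ?k" using dense by (intro mult_right_mono) auto
  also have "\<dots> \<le> real (card ?F * (?n choose (?k - 1))) * real ?k"
    using S(2) card_C by (intro mult_right_mono) (simp_all del: of_nat_mult)
  finally have "\<alpha> * real (?n - ?k + 1) * real (?n choose (?k - 1)) \<le>
        real ?k * real (card ?F) * real (?n choose (?k - 1))"
    by (simp add: algebra_simps)
  moreover have "0 < ?n choose (?k - 1)" using size by simp
  ultimately have "\<alpha> * real (?n - ?k + 1) \<le> real ?k * real (card ?F)"
    by (simp add: mult_le_cancel_right)
  then have F_large: "\<alpha> * (real ?n - real ?k + 1) \<le> real ?k * real (card ?F)"
    using size by (simp add: add.commute)
  \<comment> \<open>The elements of \<open>S\<close> make up for the difference between \<open>n - k + 1\<close> and \<open>n\<close>.\<close>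
  have "\<alpha> * (real ?k - 1) \<le> real ?k * (real ?k - 1)"
    using \<alpha>1 k by (intro mult_right_mono) auto
  then have "\<alpha> * real ?n \<le> real ?k * (real (card ?F) + (real ?k - 1))"
    using F_large by (simp add: algebra_simps)
  also have "\<dots> \<le> real ?k * real (card (\<Union>?F))"
    using large S(1) k by (intro mult_left_mono) auto
  finally have "\<alpha> / real ?k * real ?n \<le> real (card (\<Union>?F))"
    using k by (simp add: field_simps)
  with union(1,2) show ?thesis by (intro exI[of _ "\<Union>?F"] conjI)
qed

text \<open>Every transversal of the deleted blocks dominates the remainder. So if the remainder were
  not good, then all transversals would be bad.\<close>

lemma good_remainder_if_few_bad:
  assumes size: "card E * m < card I"
    and few: "card {T. T \<subseteq> I \<and> card T = card E \<and> \<not> good T} < m ^ card E"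
  shows "\<exists>J\<subseteq>I. good J \<and> card I \<le> card J + card E * m"
proof -
  obtain H where H: "\<forall>e\<in>E. H e \<subseteq> I \<and> card (H e) = m" "disjoint_family_on H E"
      "\<forall>e\<in>E. \<forall>h\<in>H e. \<forall>j\<in>I - \<Union>(H ` E). key e h \<le> key e j"
    using ex_disjoint_initial_segments[OF finite_E finite_I less_imp_le[OF size], of key]
    by metis
  let ?J = "I - \<Union>(H ` E)"
  let ?bad = "{T. T \<subseteq> I \<and> card T = card E \<and> \<not> good T}"
  have sub: "\<Union>(H ` E) \<subseteq> I" using H(1) by auto
  have "card (\<Union>(H ` E)) \<le> (\<Sum>e\<in>E. card (H e))" using finite_E by (rule card_UN_le)
  also have "\<dots> = card E * m" using H(1) by simp
  finally have large: "card I \<le> card ?J + card E * m"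
    using card_Diff_subset[OF finite_subset[OF sub finite_I] sub] by linarith
  then have "0 < card ?J" using size by linarith
  then have J_ne: "?J \<noteq> {}" by (metis card.empty less_irrefl)
  note transversals = card_transversals[OF finite_E H(2), of m]
  have "good ?J"
  proof (rule ccontr)
    assume not_good: "\<not> good ?J"
    have "(\<lambda>f. f ` E) ` PiE E H \<subseteq> ?bad"
    proof safe
      fix f x assume "f \<in> PiE E H" "x \<in> E"
      then show "f x \<in> I" using H(1) by (auto dest: PiE_mem)
    next
      fix f assume "f \<in> PiE E H"
      then show "card (f ` E) = card E" using transversals(2) H(1) by blast
    next
      fix f assume f: "f \<in> PiE E H" and "good (f ` E)"
      moreover have "f ` E \<subseteq> I" using f H(1) by (auto dest: PiE_mem)
      moreover have "\<forall>e\<in>E. \<forall>j\<in>?J. \<exists>t\<in>f ` E. key e t \<le> key e j"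
      proof (intro ballI)
        fix e j assume e: "e \<in> E" and j: "j \<in> ?J"
        have "key e (f e) \<le> key e j" using H(3) e j PiE_mem[OF f e] by blast
        then show "\<exists>t\<in>f ` E. key e t \<le> key e j" using e by blast
      qed
      ultimately show False using not_good good_if_dominated[of "f ` E" ?J] J_ne by blast
    qed
    then have "card ((\<lambda>f. f ` E) ` PiE E H) \<le> card ?bad"
      using finite_I by (intro card_mono) auto
    then show False using few transversals(1) H(1) by auto
  qed
  then show ?thesis using large by blast
qed

lemma explicit_good_subfamily:
  fixes \<alpha> :: real
  defines "\<epsilon> \<equiv> (1 - \<alpha>) powr (1 / (real (card E) + 1))"
  assumes pos: "0 < \<alpha>" and size: "card E \<le> card I"
    and size': "real (card E) / (\<epsilon> * (1 - \<epsilon>)) < real (card I)"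
    and dense: "\<alpha> * real (card I choose card E)
                  \<le> real (card {T. T \<subseteq> I \<and> card T = card E \<and> good T})"
  shows "\<exists>J\<subseteq>I. good J \<and> (1 - real (card E) * \<epsilon>) * real (card I) \<le> real (card J)"
proof -
  let ?k = "card E" and ?n = "card I"
  let ?all = "{T. T \<subseteq> I \<and> card T = ?k}"
  let ?G = "{T. T \<subseteq> I \<and> card T = ?k \<and> good T}"
  let ?bad = "{T. T \<subseteq> I \<and> card T = ?k \<and> \<not> good T}"
  have k: "1 \<le> ?k" by (rule card_E_pos)
  have fin: "finite ?all" "finite ?G" "finite ?bad" using finite_I by simp_all
  have card_all: "card ?all = ?n choose ?k" using finite_I by (simp add: n_subsets)
  have union: "?G \<union> ?bad = ?all" and disj: "?G \<inter> ?bad = {}" by blast+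
  have split: "card ?G + card ?bad = ?n choose ?k"
    using card_Un_disjoint[OF fin(2,3) disj] unfolding union card_all by (rule sym)
  have choose_pos: "0 < ?n choose ?k" using size by simp
  have "\<alpha> * real (?n choose ?k) \<le> 1 * real (?n choose ?k)" using dense split by linarith
  then have \<alpha>1: "\<alpha> \<le> 1" using choose_pos by (simp add: mult_le_cancel_right)
  have "real (card ?G) + real (card ?bad) = real (?n choose ?k)"
    using arg_cong[OF split, of real] by (simp only: of_nat_add)
  then have bad: "real (card ?bad) \<le> (1 - \<alpha>) * real (?n choose ?k)"
    using dense by (simp add: algebra_simps)
  show ?thesis
  proof (cases "\<alpha> = 1")
    case True
    then have "card ?bad = 0" using bad by simp
    then have "?bad = {}" using fin by simp
    then have "good I" using good_if_all_good[OF size] by blast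
    moreover have "\<epsilon> = 0" using True by (simp add: \<epsilon>_def)
    ultimately show ?thesis by auto
  next
    case False
    then have \<alpha>: "0 < 1 - \<alpha>" "1 - \<alpha> < 1" using \<alpha>1 pos by auto
    have \<epsilon>: "0 < \<epsilon>" "\<epsilon> < 1"
      using \<alpha> powr_less_mono2[of "1 / (real ?k + 1)" "1 - \<alpha>" 1] by (auto simp: \<epsilon>_def)
    have "\<epsilon> ^ Suc ?k = \<epsilon> powr (real ?k + 1)"
      by (simp only: powr_realpow[OF \<epsilon>(1), symmetric] of_nat_Suc add.commute)
    also have "\<dots> = 1 - \<alpha>" using \<alpha> unfolding \<epsilon>_def powr_powr by simp
    finally have \<epsilon>_pow: "\<epsilon> ^ Suc ?k = 1 - \<alpha>" .
    show ?thesis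
    proof (cases "real ?k * \<epsilon> < 1")
      case False
      \<comment> \<open>The bound is not positive, so any good set will do.\<close>
      have "0 < \<alpha> * real (?n choose ?k)" using pos choose_pos by simp
      then have "?G \<noteq> {}" using dense by (metis card.empty not_less of_nat_0)
      then obtain T where "T \<subseteq> I" "good T" by blast
      moreover have "(1 - real ?k * \<epsilon>) * real ?n \<le> 0"
        using False by (intro mult_nonpos_nonneg) auto
      ultimately show ?thesis by (meson of_nat_0_le_iff order_trans)
    next
      case True
      define m where "m = nat \<lfloor>\<epsilon> * real ?n\<rfloor>"
      have "real m \<le> \<epsilon> * real ?n" using \<epsilon> unfolding m_def by simp
      then have km: "real ?k * real m \<le> real ?k * \<epsilon> * real ?n"
        by (simp add: mult.assoc mult_left_mono)
      have "0 < real ?n" using size k by simp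
      then have "real ?k * \<epsilon> * real ?n < 1 * real ?n"
        using True by (intro mult_strict_right_mono) auto
      then have "real (?k * m) < real ?n" using km by simp
      then have km_lt: "?k * m < ?n" by (simp only: of_nat_less_iff)
      have "real (card ?bad) \<le> (1 - \<alpha>) * real ?n ^ ?k"
      proof -
        have "real (?n choose ?k) \<le> real (?n ^ ?k)"
          using binomial_le_pow[OF size] by (simp only: of_nat_le_iff)
        then have "(1 - \<alpha>) * real (?n choose ?k) \<le> (1 - \<alpha>) * real ?n ^ ?k"
          using \<alpha> by simp
        then show ?thesis using bad by linarith
      qed
      also have "\<dots> < real m ^ ?k"
        using power_floor_gt[OF \<epsilon> k size'] unfolding \<epsilon>_pow m_def .
      finally have "real (card ?bad) < real (m ^ ?k)" by simp
      then have "card ?bad < m ^ ?k" by (simp only: of_nat_less_iff)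
      then obtain J where J: "J \<subseteq> I" "good J" "?n \<le> card J + ?k * m"
        using good_remainder_if_few_bad[OF km_lt] by blast
      have "real ?n \<le> real (card J) + real ?k * real m"
        using J(3) by (metis of_nat_add of_nat_le_iff of_nat_mult)
      then have "(1 - real ?k * \<epsilon>) * real ?n \<le> real (card J)"
        using km by (simp add: left_diff_distrib)
      then show ?thesis using J by blast
    qed
  qed
qed

end

section \<open>Boxes\<close>

lemma Int_boxes:
  assumes "A \<in> boxes" "C \<in> boxes"
  shows "A \<inter> C \<in> boxes"
proof -
  obtain a b c d where AC: "A = cbox a b" "C = cbox c d"
    using assms unfolding boxes_def by blast
  have "A \<inter> C = cbox (\<chi> i. max (a $ i) (c $ i)) (\<chi> i. min (b $ i) (d $ i))"
    unfolding AC by (auto simp: mem_box_cart)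
  then show ?thesis unfolding boxes_def by blast
qed

lemma Inter_boxes:
  assumes "finite J" "J \<noteq> {}" "\<forall>j\<in>J. B j \<in> boxes"
  shows "(\<Inter>j\<in>J. B j) \<in> boxes"
  using assms
proof (induction J rule: finite_ne_induct)
  case (singleton x)
  then show ?case by simp
next
  case (insert x F)
  then show ?case by (simp add: Int_boxes)
qed

text \<open>The directions are \<open>(i, False)\<close> and \<open>(i, True)\<close> for the lower and the upper bound of the
  coordinate \<open>i\<close>; lower bounds are negated, as a large lower bound is a tight one.\<close>

lemma boxes_domination:
  fixes P :: "(real ^ 'n) set set" and I :: "nat set"
  assumes "monotone_property P" "finite I" "\<forall>i\<in>I. B i \<in> boxes"
  shows "\<exists>key. domination I (UNIV :: ('n \<times> bool) set) key (P_intersecting P B)"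
proof -
  have "\<exists>a b. B i = cbox a b" if "i \<in> I" for i
    using bspec[OF assms(3) that] by (simp add: boxes_def)
  then obtain lo hi where cbox: "\<And>i. i \<in> I \<Longrightarrow> B i = cbox (lo i) (hi i)"
    by metis
  define key :: "'n \<times> bool \<Rightarrow> nat \<Rightarrow> real" where
    "key = (\<lambda>(i, upper) j. if upper then hi j $ i else - (lo j $ i))"
  have "domination I (UNIV :: ('n \<times> bool) set) key (P_intersecting P B)"
  proof
    show "finite I" by (rule assms(2))
  next
    fix T J
    assume T: "T \<subseteq> I" "P_intersecting P B T" and J: "J \<subseteq> I" "J \<noteq> {}"
      and dom: "\<forall>e\<in>UNIV. \<forall>j\<in>J. \<exists>t\<in>T. key e t \<le> key e j"
    have "(\<Inter>t\<in>T. B t) \<subseteq> (\<Inter>j\<in>J. B j)"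
    proof (rule INT_greatest, rule subsetI)
      fix j x assume j: "j \<in> J" and x: "x \<in> (\<Inter>t\<in>T. B t)"
      have bounds: "lo t $ i \<le> x $ i" "x $ i \<le> hi t $ i" if "t \<in> T" for t i
      proof -
        have "x \<in> B t" "t \<in> I" using that x T(1) by blast+
        then have "x \<in> cbox (lo t) (hi t)" using cbox by simp
        then show "lo t $ i \<le> x $ i" "x $ i \<le> hi t $ i" by (simp_all add: mem_box_cart)
      qed
      have "lo j $ i \<le> x $ i \<and> x $ i \<le> hi j $ i" for i
      proof
        obtain t where "t \<in> T" "key (i, False) t \<le> key (i, False) j" using dom j by blast
        then show "lo j $ i \<le> x $ i" using bounds(1)[of t i] by (simp add: key_def)
        obtain t where "t \<in> T" "key (i, True) t \<le> key (i, True) j" using dom j by blast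
        then show "x $ i \<le> hi j $ i" using bounds(2)[of t i] by (simp add: key_def)
      qed
      then show "x \<in> B j" using cbox[of j] j J(1) by (auto simp: mem_box_cart)
    qed
    moreover have "(\<Inter>j\<in>J. B j) \<in> boxes"
      using J assms(2,3) by (intro Inter_boxes) (auto intro: finite_subset)
    ultimately show "P_intersecting P B J"
      using T(2) assms(1) unfolding P_intersecting_def monotone_property_def by blast
  qed auto
  then show ?thesis by blast
qed

theorem theorem1p6:
  fixes \<alpha> :: real
  assumes "\<alpha> > 0"
  shows
    "(\<exists>\<beta>>0. \<forall>(P :: (real ^ 'n) set set) (I :: nat set) B.
        monotone_property P \<longrightarrow> finite I \<longrightarrow> (\<forall>i\<in>I. B i \<in> boxes) \<longrightarrow>
        card I \<ge> 2 * CARD('n) \<longrightarrow>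
        real (card {J. J \<subseteq> I \<and> card J = 2 * CARD('n) \<and> P_intersecting P B J})
          \<ge> \<alpha> * real (card I choose (2 * CARD('n))) \<longrightarrow>
        (\<exists>J\<subseteq>I. P_intersecting P B J \<and> real (card J) \<ge> \<beta> * real (card I)))
     \<and>
     (\<exists>N. \<forall>(P :: (real ^ 'n) set set) (I :: nat set) B.
        monotone_property P \<longrightarrow> finite I \<longrightarrow> (\<forall>i\<in>I. B i \<in> boxes) \<longrightarrow>
        card I \<ge> N \<longrightarrow>
        real (card {J. J \<subseteq> I \<and> card J = 2 * CARD('n) \<and> P_intersecting P B J})
          \<ge> \<alpha> * real (card I choose (2 * CARD('n))) \<longrightarrow>
        (\<exists>J\<subseteq>I. P_intersecting P B J \<and>
           real (card J) \<ge>
             (1 - 2 * real CARD('n) * (1 - \<alpha>) powr (1 / (2 * real CARD('n) + 1))) * real (card I)))"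
proof (intro conjI)
  let ?k = "2 * CARD('n)"
  let ?E = "UNIV :: ('n \<times> bool) set"
  have card_E: "card ?E = ?k" by simp
  show "\<exists>\<beta>>0. \<forall>(P :: (real ^ 'n) set set) (I :: nat set) B.
        monotone_property P \<longrightarrow> finite I \<longrightarrow> (\<forall>i\<in>I. B i \<in> boxes) \<longrightarrow>
        card I \<ge> ?k \<longrightarrow>
        real (card {J. J \<subseteq> I \<and> card J = ?k \<and> P_intersecting P B J})
          \<ge> \<alpha> * real (card I choose ?k) \<longrightarrow>
        (\<exists>J\<subseteq>I. P_intersecting P B J \<and> real (card J) \<ge> \<beta> * real (card I))"
  proof (rule exI[of _ "\<alpha> / real ?k"], intro conjI allI impI)
    show "0 < \<alpha> / real ?k" using assms by simp
  next
    fix P :: "(real ^ 'n) set set" and I :: "nat set" and B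
    assume hyps: "monotone_property P" "finite I" "\<forall>i\<in>I. B i \<in> boxes"
      and size: "card I \<ge> ?k"
      and dense: "real (card {J. J \<subseteq> I \<and> card J = ?k \<and> P_intersecting P B J})
          \<ge> \<alpha> * real (card I choose ?k)"
    obtain key where "domination I ?E key (P_intersecting P B)"
      using boxes_domination[OF hyps] by blast
    from domination.linear_size_good_subfamily[OF this assms, unfolded card_E, OF size dense]
    show "\<exists>J\<subseteq>I. P_intersecting P B J \<and> real (card J) \<ge> \<alpha> / real ?k * real (card I)" .
  qed
  define \<epsilon> where "\<epsilon> = (1 - \<alpha>) powr (1 / (real ?k + 1))"
  have \<epsilon>_eq: "(1 - \<alpha>) powr (1 / (2 * real CARD('n) + 1)) = \<epsilon>" by (simp add: \<epsilon>_def)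
  define N where "N = max ?k (nat \<lfloor>real ?k / (\<epsilon> * (1 - \<epsilon>))\<rfloor> + 1)"
  show "\<exists>N. \<forall>(P :: (real ^ 'n) set set) (I :: nat set) B.
        monotone_property P \<longrightarrow> finite I \<longrightarrow> (\<forall>i\<in>I. B i \<in> boxes) \<longrightarrow>
        card I \<ge> N \<longrightarrow>
        real (card {J. J \<subseteq> I \<and> card J = ?k \<and> P_intersecting P B J})
          \<ge> \<alpha> * real (card I choose ?k) \<longrightarrow>
        (\<exists>J\<subseteq>I. P_intersecting P B J \<and>
           real (card J) \<ge>
             (1 - 2 * real CARD('n) * (1 - \<alpha>) powr (1 / (2 * real CARD('n) + 1))) * real (card I))"
    unfolding \<epsilon>_eq
  proof (rule exI[of _ N], intro allI impI)
    fix P :: "(real ^ 'n) set set" and I :: "nat set" and B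
    assume hyps: "monotone_property P" "finite I" "\<forall>i\<in>I. B i \<in> boxes"
      and N: "card I \<ge> N"
      and dense: "real (card {J. J \<subseteq> I \<and> card J = ?k \<and> P_intersecting P B J})
          \<ge> \<alpha> * real (card I choose ?k)"
    have size: "?k \<le> card I" using N by (simp add: N_def)
    have "nat \<lfloor>real ?k / (\<epsilon> * (1 - \<epsilon>))\<rfloor> + 1 \<le> card I" using N by (simp add: N_def)
    then have size': "real ?k / (\<epsilon> * (1 - \<epsilon>)) < real (card I)" by linarith
    obtain key where "domination I ?E key (P_intersecting P B)"
      using boxes_domination[OF hyps] by blast
    from domination.explicit_good_subfamily[OF this assms, unfolded card_E, folded \<epsilon>_def,
        OF size size' dense]
    show "\<exists>J\<subseteq>I. P_intersecting P B J \<and>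
        real (card J) \<ge> (1 - 2 * real CARD('n) * \<epsilon>) * real (card I)" by simp
  qed
qed

end
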